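(* Let $F=(F_1,\dots,F_n)^T:\mathbb{R}^n\to\mathbb{R}^n$ be monotone, $L$-Lipschitz continuous, and componentwise Lipschitz continuous with constants $l_1,\dots,l_n>0$, and let $l_{\max}=\max_{1\le i\le n} l_i$. Let $\Omega\subseteq\mathbb{R}^n$ be nonempty, closed and convex, let $\boldsymbol{x}^*\in\Omega$ satisfy $F(\boldsymbol{x}^* )=\boldsymbol{0}$, and let $\rho\in(0,1)$, $\gamma\ge0$. Let $\{\boldsymbol{x}_k\}_{k\ge0}$, $\{\boldsymbol{y}_k\}_{k\ge0}$ be the random sequences generated by the Random Mini-EG method (defined in the context) from a deterministic initial point $\boldsymbol{x}_0\in\mathbb{R}^n$. Then for every integer $K\ge0$, $$\min_{0\le k\le K}\mathbb{E}\left[\frac{\|F^2(\boldsymbol{x}_k)\|_{[\gamma]}^2}{\|F(\boldsymbol{x}_k)\|^2}\right]\;\le\;\frac{\big(\sum_{i=1}^n l_i^\gamma\big)(l_{\max}+\rho L)^2}{\rho^2(1-\rho)^2(K+1)}\,\|\boldsymbol{x}_0-\boldsymbol{x}^*\|^2 ,$$ and furthermore $$\liminf_{k\to\infty}\mathbb{E}\big[\|F(\boldsymbol{x}_k)\|\big]=0 .$$ Here the expectation of a quantity depending on $\boldsymbol{x}_k$ is taken over the random indices $i_0,\dots,i_{k-1}$.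
   Context: $\|\cdot\|$ is the Euclidean norm, $e_i$ the $i$-th standard basis vector, $P_\Omega$ the Euclidean projection onto $\Omega$. Monotone: $\langle F(\boldsymbol{x})-F(\boldsymbol{y}),\boldsymbol{x}-\boldsymbol{y}\rangle\ge0$ for all $\boldsymbol{x},\boldsymbol{y}\in\mathbb{R}^n$. $L$-Lipschitz: $\|F(\boldsymbol{x})-F(\boldsymbol{y})\|\le L\|\boldsymbol{x}-\boldsymbol{y}\|$ for all $\boldsymbol{x},\boldsymbol{y}\in\mathbb{R}^n$. Componentwise Lipschitz with constants $l_1,\dots,l_n>0$: $|F_i(\boldsymbol{x}+te_i)-F_i(\boldsymbol{x})|\le l_i|t|$ for all $i$, all $\boldsymbol{x}\in\mathbb{R}^n$, $t\in\mathbb{R}$. Notation: $F^2(\boldsymbol{x})=[F_1(\boldsymbol{x})^2,\dots,F_n(\boldsymbol{x})^2]^T$, and $\|\boldsymbol{x}\|_{[\gamma]}=\sqrt{\sum_{i=1}^n l_i^\gamma x_i^2}$; thus $\|F^2(\boldsymbol{x})\|_{[\gamma]}^2=\sum_{i=1}^n l_i^\gamma F_i(\boldsymbol{x})^4$. The ratio $\|F^2(\boldsymbol{x})\|_{[\gamma]}^2/\|F(\boldsymbol{x})\|^2$ is read as $0$ when $F(\boldsymbol{x})=\boldsymbol{0}$. Random Mini-EG method: given $\boldsymbol{x}_0\in\mathbb{R}^n$, for $k=0,1,2,\dots$ draw $i_k\in\{1,\dots,n\}$, independently across iterations, with $\Pr(i_k=i)=l_i^\gamma/\sum_{j=1}^n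 l_j^\gamma$, and set $$\boldsymbol{y}_k=\boldsymbol{x}_k-\frac{\rho}{l_{i_k}}F_{i_k}(\boldsymbol{x}_k)e_{i_k},\qquad \boldsymbol{x}_{k+1}=P_\Omega\big(\boldsymbol{x}_k-\beta_kF(\boldsymbol{y}_k)\big),\qquad \beta_k=\frac{\rho\,F_{i_k}(\boldsymbol{y}_k)F_{i_k}(\boldsymbol{x}_k)}{l_{i_k}\|F(\boldsymbol{y}_k)\|^2},$$ with the convention $\beta_k=0$ if $F(\boldsymbol{y}_k)=\boldsymbol{0}$. *)

theory Defs
  imports "HOL-Probability.Probability"
begin

definition monotone_op :: "('a::real_inner \<Rightarrow> 'a) \<Rightarrow> bool"
  where "monotone_op F \<longleftrightarrow> (\<forall>x y. (F x - F y) \<bullet> (x - y) \<ge> 0)"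

definition componentwise_lipschitz :: "('n::finite \<Rightarrow> real) \<Rightarrow> (real^'n \<Rightarrow> real^'n) \<Rightarrow> bool"
  where "componentwise_lipschitz l F \<longleftrightarrow>
    (\<forall>i x t. \<bar>F (x + t *\<^sub>R axis i 1) $ i - F x $ i\<bar> \<le> l i * \<bar>t\<bar>)"

definition square_vec :: "real^'n \<Rightarrow> real^'n"
  where "square_vec v = (\<chi> i. (v $ i)\<^sup>2)"

definition weighted_norm :: "('n::finite \<Rightarrow> real) \<Rightarrow> real \<Rightarrow> real^'n \<Rightarrow> real"
  where "weighted_norm l \<gamma> v = sqrt (\<Sum>i\<in>UNIV. l i powr \<gamma> * (v $ i)\<^sup>2)"

definition mini_eg_y ::
  "(real^'n \<Rightarrow> real^'n) \<Rightarrow> ('n::finite \<Rightarrow> real) \<Rightarrow> real \<Rightarrow> 'n \<Rightarrow> real^'n \<Rightarrow> real^'n"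
  where "mini_eg_y F l \<rho> i x = x - (\<rho> / l i * F x $ i) *\<^sub>R axis i 1"

(* Division by zero yields 0, so the step size is 0 whenever F vanishes at the point y. *)
definition mini_eg_beta ::
  "(real^'n \<Rightarrow> real^'n) \<Rightarrow> ('n::finite \<Rightarrow> real) \<Rightarrow> real \<Rightarrow> 'n \<Rightarrow> real^'n \<Rightarrow> real"
  where "mini_eg_beta F l \<rho> i x =
    (let y = mini_eg_y F l \<rho> i x
     in \<rho> * F y $ i * F x $ i / (l i * (norm (F y))\<^sup>2))"

(* For a nonempty closed convex set the library's closest_point is the Euclidean projection. *)
definition mini_eg_step ::
  "(real^'n \<Rightarrow> real^'n) \<Rightarrow> ('n::finite \<Rightarrow> real) \<Rightarrow> real \<Rightarrow> (real^'n) set \<Rightarrow> 'n \<Rightarrow> real^'n \<Rightarrow> real^'n"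
  where "mini_eg_step F l \<rho> \<Omega> i x =
    closest_point \<Omega> (x - mini_eg_beta F l \<rho> i x *\<^sub>R F (mini_eg_y F l \<rho> i x))"

(* The k-th iterate along a realised index sequence s; it depends only on s 0, ..., s (k - 1). *)
primrec mini_eg ::
  "(real^'n \<Rightarrow> real^'n) \<Rightarrow> ('n::finite \<Rightarrow> real) \<Rightarrow> real \<Rightarrow> (real^'n) set \<Rightarrow> real^'n
    \<Rightarrow> (nat \<Rightarrow> 'n) \<Rightarrow> nat \<Rightarrow> real^'n"
  where
    "mini_eg F l \<rho> \<Omega> x0 s 0 = x0"
  | "mini_eg F l \<rho> \<Omega> x0 s (Suc k) = mini_eg_step F l \<rho> \<Omega> (s k) (mini_eg F l \<rho> \<Omega> x0 s k)"

definition mini_eg_sampling ::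
  "('n::finite \<Rightarrow> real) \<Rightarrow> real \<Rightarrow> 'w measure \<Rightarrow> (nat \<Rightarrow> 'w \<Rightarrow> 'n) \<Rightarrow> bool"
  where "mini_eg_sampling l \<gamma> M I \<longleftrightarrow>
    prob_space M \<and>
    prob_space.indep_vars M (\<lambda>_. count_space UNIV) I UNIV \<and>
    (\<forall>k i. measure M {\<omega> \<in> space M. I k \<omega> = i} = l i powr \<gamma> / (\<Sum>j\<in>UNIV. l j powr \<gamma>))"

(* The iterates take finitely many values, so every function of an iterate is integrable:
   no expectation of such a quantity falls back on the default value 0 of the integral. *)
lemma integrable_mini_eg:
  fixes g :: "real^'n::finite \<Rightarrow> real"
  assumes "mini_eg_sampling l \<gamma> M I"
  shows "integrable M (\<lambda>\<omega>. g (mini_eg F l \<rho> \<Omega> x0 (\<lambda>j. I j \<omega>) k))"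
proof -
  interpret prob_space M
    using assms by (simp add: mini_eg_sampling_def)
  have meas: "I j \<in> measurable M (count_space UNIV)" for j
    using assms by (simp add: mini_eg_sampling_def indep_vars_def2)
  have idx: "simple_function M (I j)" for j
    unfolding simple_function_def
  proof (intro conjI ballI)
    show "finite (I j ` space M)" by simp
    show "I j -` {i} \<inter> space M \<in> events" for i
      using measurable_sets[OF meas[of j], of "{i}"] by simp
  qed
  have it: "simple_function M (\<lambda>\<omega>. mini_eg F l \<rho> \<Omega> x0 (\<lambda>j. I j \<omega>) k)"
  proof (induction k)
    case 0
    show ?case by simp
  next
    case (Suc k)
    show ?case
      using simple_function_compose2[OF idx[of k] Suc, of "mini_eg_step F l \<rho> \<Omega>"] by simp
  qed
  have simp_g: "simple_function M (\<lambda>\<omega>. g (mini_eg F l \<rho> \<Omega> x0 (\<lambda>j. I j \<omega>) k))"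
    using simple_function_compose1[OF it, of g] by simp
  show ?thesis
  proof (rule integrableI_bounded_set[where A = "space M"
        and B = "Max ((\<lambda>\<omega>. norm (g (mini_eg F l \<rho> \<Omega> x0 (\<lambda>j. I j \<omega>) k))) ` space M)"])
    have "finite ((\<lambda>\<omega>. norm (g (mini_eg F l \<rho> \<Omega> x0 (\<lambda>j. I j \<omega>) k))) ` space M)"
      using simple_functionD(1)[OF simple_function_compose1[OF simp_g, of norm]] by simp
    then show "AE \<omega> in M. \<omega> \<in> space M \<longrightarrow> norm (g (mini_eg F l \<rho> \<Omega> x0 (\<lambda>j. I j \<omega>) k))
        \<le> Max ((\<lambda>\<omega>. norm (g (mini_eg F l \<rho> \<Omega> x0 (\<lambda>j. I j \<omega>) k))) ` space M)"
      by (intro AE_I2 impI Max_ge) auto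
  qed (use simp_g in \<open>auto simp: emeasure_space_1 intro: borel_measurable_simple_function\<close>)
qed

end

theory Submission
  imports Defs
begin

text \<open>One step decreases the squared distance to the solution by at least a multiple of
  \<open>F\<^sub>i(x)\<^sup>4 / \<parallel>F(x)\<parallel>\<^sup>2\<close>: componentwise Lipschitz continuity keeps \<open>F\<^sub>i(y)\<close> within a factor
  \<open>1 - \<rho>\<close> of \<open>F\<^sub>i(x)\<close>, and the step size is the exact minimiser of the quadratic upper bound on the
  new squared distance that monotonicity provides. Since the current index is independent of the
  current iterate, taking expectations replaces \<open>F\<^sub>i(x)\<^sup>4\<close> by the weighted sum, and telescoping makes
  the expected ratios summable. This bounds their minimum and forces them to \<open>0\<close>; as they dominate
  \<open>\<parallel>F(x)\<parallel>\<^sup>2\<close> up to a constant, the expected norms tend to \<open>0\<close> too.\<close>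

section \<open>The weighted norm of squares against the Euclidean norm\<close>

lemma weighted_norm_square_vec_sq:
  assumes "\<And>i. l i > 0"
  shows "(weighted_norm l \<gamma> (square_vec v))\<^sup>2 = (\<Sum>i\<in>UNIV. l i powr \<gamma> * (v $ i)^4)"
proof -
  have "(\<Sum>i\<in>UNIV. l i powr \<gamma> * (v $ i)^4) \<ge> 0"
    by (intro sum_nonneg) simp
  then show ?thesis
    by (simp add: weighted_norm_def square_vec_def flip: power_mult)
qed

text \<open>Cauchy-Schwarz on \<open>(v $ i)^2\<close>, split into
  \<open>1 / sqrt (l i powr \<gamma>)\<close> and its complement, bounds the fourth power of the
  norm. This turns decay of the ratio into decay of \<open>norm v\<close>.\<close>

lemma norm_sq_le_weighted_norm_ratio:
  fixes l :: "'n::finite \<Rightarrow> real" and \<gamma> :: real and v :: "real^'n"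
  assumes l: "\<And>i. l i > 0"
  defines "c \<equiv> \<Sum>i\<in>UNIV. 1 / l i powr \<gamma>"
  shows "(norm v)\<^sup>2 \<le> c * ((weighted_norm l \<gamma> (square_vec v))\<^sup>2 / (norm v)\<^sup>2)"
proof (cases "v = 0")
  case False
  have "(norm v)\<^sup>2 = (\<Sum>i\<in>UNIV. (v $ i)\<^sup>2)"
    by (simp add: norm_vec_def L2_set_def sum_nonneg)
  also have "\<dots> = (\<Sum>i\<in>UNIV. 1 / sqrt (l i powr \<gamma>) * (sqrt (l i powr \<gamma>) * (v $ i)\<^sup>2))"
    using l by (intro sum.cong) (simp_all add: less_imp_neq[THEN not_sym])
  finally have norm_eq: "(norm v)\<^sup>2 = \<dots>" .
  have "((norm v)\<^sup>2)\<^sup>2 \<le> (\<Sum>i\<in>UNIV. (1 / sqrt (l i powr \<gamma>))\<^sup>2)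
      * (\<Sum>i\<in>UNIV. (sqrt (l i powr \<gamma>) * (v $ i)\<^sup>2)\<^sup>2)"
    unfolding norm_eq by (rule Cauchy_Schwarz_ineq_sum)
  also have "\<dots> = c * (weighted_norm l \<gamma> (square_vec v))\<^sup>2"
    unfolding weighted_norm_square_vec_sq[OF l] c_def
    by (simp add: power_divide power_mult_distrib flip: power_mult)
  finally show ?thesis
    using False by (simp add: field_simps power2_eq_square)
qed simp

section \<open>Descent in one step with a fixed index\<close>

lemma closest_point_dist_le:
  assumes "convex S" "closed S" "z \<in> S"
  shows "norm (closest_point S x - z) \<le> norm (x - z)"
  using closest_point_lipschitz[of S x z] assms closest_point_self[of z S]
  by (auto simp: dist_norm)

text \<open>The extrapolation moves only coordinate \<open>i\<close>, by
  \<open>\<rho> / l i * \<bar>F x $ i\<bar>\<close>, so component \<open>i\<close> of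
  \<open>F\<close> changes by at most \<open>\<rho> * \<bar>F x $ i\<bar>\<close>. For
  \<open>\<rho> < 1\<close> the step size therefore has a nonnegative numerator.\<close>

lemma componentwise_lipschitz_product_ge:
  fixes F :: "real^'n::finite \<Rightarrow> real^'n"
  assumes cl: "componentwise_lipschitz l F" and l: "l i > 0" and "0 < \<rho>"
  shows "(1 - \<rho>) * (F x $ i)\<^sup>2 \<le> F (mini_eg_y F l \<rho> i x) $ i * F x $ i"
proof -
  let ?y = "mini_eg_y F l \<rho> i x" and ?t = "- (\<rho> / l i * F x $ i)"
  have "?y = x + ?t *\<^sub>R axis i 1"
    by (simp add: mini_eg_y_def)
  then have "\<bar>F ?y $ i - F x $ i\<bar> \<le> l i * \<bar>?t\<bar>"
    using cl unfolding componentwise_lipschitz_def by metis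
  also have "\<dots> = \<rho> * \<bar>F x $ i\<bar>"
    using l \<open>0 < \<rho>\<close> by (simp add: abs_mult)
  finally have "\<bar>F ?y $ i - F x $ i\<bar> * \<bar>F x $ i\<bar> \<le> \<rho> * \<bar>F x $ i\<bar> * \<bar>F x $ i\<bar>"
    by (rule mult_right_mono) simp
  moreover have "\<rho> * \<bar>F x $ i\<bar> * \<bar>F x $ i\<bar> = \<rho> * (F x $ i)\<^sup>2"
    by (simp add: power2_eq_square mult.assoc)
  ultimately have "\<bar>(F ?y $ i - F x $ i) * F x $ i\<bar> \<le> \<rho> * (F x $ i)\<^sup>2"
    by (simp add: abs_mult)
  then have "- (\<rho> * (F x $ i)\<^sup>2) \<le> (F ?y $ i - F x $ i) * F x $ i"
    by linarith
  then show ?thesis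
    by (simp add: algebra_simps power2_eq_square)
qed

text \<open>The full Lipschitz constant controls the change of \<open>F\<close> over the same move.
  This allows \<open>norm (F x)\<close> to replace \<open>norm (F y)\<close> in the denominator of
  the decrease.\<close>

lemma norm_at_mini_eg_y_le:
  fixes F :: "real^'n::finite \<Rightarrow> real^'n"
  assumes lip: "L-lipschitz_on UNIV F" and l: "l i > 0" and "0 < \<rho>"
  shows "l i * norm (F (mini_eg_y F l \<rho> i x)) \<le> (l i + \<rho> * L) * norm (F x)"
proof -
  let ?y = "mini_eg_y F l \<rho> i x"
  have "norm (F ?y - F x) \<le> L * norm (?y - x)"
    using lipschitz_onD[OF lip, of ?y x] by (simp add: dist_norm)
  also have "norm (?y - x) = \<rho> / l i * \<bar>F x $ i\<bar>"
    using l \<open>0 < \<rho>\<close> by (simp add: mini_eg_y_def abs_mult)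
  also have "L * (\<rho> / l i * \<bar>F x $ i\<bar>) \<le> L * (\<rho> / l i * norm (F x))"
    using lipschitz_on_nonneg[OF lip] l \<open>0 < \<rho>\<close>
    by (intro mult_left_mono component_le_norm_cart) auto
  finally have "norm (F ?y) \<le> norm (F x) + L * (\<rho> / l i * norm (F x))"
    using norm_triangle_ineq[of "F x" "F ?y - F x"] by simp
  then have "l i * norm (F ?y) \<le> l i * (norm (F x) + L * (\<rho> / l i * norm (F x)))"
    using l by simp
  also have "\<dots> = (l i + \<rho> * L) * norm (F x)"
    using l by (simp add: field_simps)
  finally show ?thesis .
qed

text \<open>Projection is nonexpansive and fixes \<open>z\<close>, so it can only help. Monotonicity
  against \<open>F z = 0\<close> bounds the linear term of the expanded square, leaving a quadratic
  in the step size.\<close>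

lemma mini_eg_step_dist_le:
  fixes F :: "real^'n::finite \<Rightarrow> real^'n" and x :: "real^'n"
  assumes mono: "monotone_op F" and l: "l i > 0" and cl: "componentwise_lipschitz l F"
    and \<Omega>: "closed \<Omega>" "convex \<Omega>" "z \<in> \<Omega>" and z: "F z = 0" and \<rho>: "0 < \<rho>" "\<rho> < 1"
  defines "y \<equiv> mini_eg_y F l \<rho> i x"
  shows "(norm (mini_eg_step F l \<rho> \<Omega> i x - z))\<^sup>2
    \<le> (norm (x - z))\<^sup>2 - (\<rho> * (F y $ i * F x $ i) / (l i * norm (F y)))\<^sup>2"
proof -
  define s \<beta> where "s = \<rho> * (F y $ i * F x $ i) / l i" and "\<beta> = mini_eg_beta F l \<rho> i x"
  have prod_ge: "(1 - \<rho>) * (F x $ i)\<^sup>2 \<le> F y $ i * F x $ i"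
    unfolding y_def by (rule componentwise_lipschitz_product_ge[OF cl l \<rho>(1)])
  have "0 \<le> (1 - \<rho>) * (F x $ i)\<^sup>2"
    using \<rho> by simp
  with prod_ge have "0 \<le> F y $ i * F x $ i"
    by (rule order_trans[rotated])
  then have "s \<ge> 0"
    unfolding s_def using \<rho> l by (intro divide_nonneg_pos mult_nonneg_nonneg[of \<rho>]) auto
  have \<beta>: "\<beta> = s / (norm (F y))\<^sup>2"
    by (simp add: \<beta>_def mini_eg_beta_def s_def y_def Let_def)
  \<comment> \<open>The last summand is exactly \<open>s\<close>; the first is nonnegative by
    monotonicity.\<close>
  have "F y \<bullet> (x - z) = F y \<bullet> (y - z) + \<rho> / l i * F x $ i * (F y \<bullet> axis i 1)"
    by (simp add: y_def mini_eg_y_def inner_diff_right)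
  moreover have "F y \<bullet> (y - z) \<ge> 0"
    using mono z unfolding monotone_op_def by (metis diff_zero)
  ultimately have inner_ge: "s \<le> F y \<bullet> (x - z)"
    by (simp add: s_def inner_axis mult_ac)
  have "(norm (mini_eg_step F l \<rho> \<Omega> i x - z))\<^sup>2 \<le> (norm (x - \<beta> *\<^sub>R F y - z))\<^sup>2"
    unfolding mini_eg_step_def y_def \<beta>_def
    by (intro power_mono closest_point_dist_le \<Omega>) simp
  also have "\<dots> = (norm (x - z))\<^sup>2 - 2 * \<beta> * (F y \<bullet> (x - z)) + \<beta>\<^sup>2 * (norm (F y))\<^sup>2"
    unfolding power2_norm_eq_inner
    by (simp add: inner_diff_left inner_diff_right inner_commute algebra_simps power2_eq_square)
  also have "\<dots> \<le> (norm (x - z))\<^sup>2 - 2 * \<beta> * s + \<beta>\<^sup>2 * (norm (F y))\<^sup>2"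
    using mult_left_mono[OF inner_ge, of "2 * \<beta>"] \<open>s \<ge> 0\<close> by (simp add: \<beta>)
  \<comment> \<open>\<open>\<beta>\<close> is the minimiser of this quadratic. If
    \<open>F y = 0\<close>, division by zero makes both corrections vanish.\<close>
  also have "\<dots> = (norm (x - z))\<^sup>2 - (s / norm (F y))\<^sup>2"
    by (cases "F y = 0") (simp_all add: \<beta> field_simps power2_eq_square)
  finally show ?thesis
    by (simp add: s_def)
qed

text \<open>The two preceding estimates express the decrease through \<open>F x\<close> alone.
  Passing from \<open>l i\<close> to the maximum makes \<open>C\<close> the same for every index, so
  that the bound can be averaged over \<open>i\<close>.\<close>

lemma mini_eg_step_descent:
  fixes F :: "real^'n::finite \<Rightarrow> real^'n"
  assumes mono: "monotone_op F" and lip: "L-lipschitz_on UNIV F"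
    and l: "\<And>i. l i > 0" and cl: "componentwise_lipschitz l F"
    and \<Omega>: "closed \<Omega>" "convex \<Omega>" "z \<in> \<Omega>" and z: "F z = 0" and \<rho>: "0 < \<rho>" "\<rho> < 1"
  defines "C \<equiv> \<rho>\<^sup>2 * (1 - \<rho>)\<^sup>2 / (Max (range l) + \<rho> * L)\<^sup>2"
  shows "(norm (mini_eg_step F l \<rho> \<Omega> i x - z))\<^sup>2
    \<le> (norm (x - z))\<^sup>2 - C * ((F x $ i)^4 / (norm (F x))\<^sup>2)"
proof -
  define y a q B where "y = mini_eg_y F l \<rho> i x" and "a = F x $ i" and "q = F y $ i * F x $ i"
    and "B = Max (range l) + \<rho> * L"
  have "l i \<le> Max (range l)"
    by simp
  moreover have "L \<ge> 0"
    by (rule lipschitz_on_nonneg[OF lip])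
  moreover from this have "l i + \<rho> * L > 0"
    using l[of i] \<rho> by (simp add: add_pos_nonneg)
  ultimately have B: "l i + \<rho> * L \<le> B" "B > 0"
    unfolding B_def by linarith+
  have q: "(1 - \<rho>) * a\<^sup>2 \<le> q"
    unfolding q_def a_def y_def by (rule componentwise_lipschitz_product_ge[OF cl l \<rho>(1)])
  have "C * (a^4 / (norm (F x))\<^sup>2) \<le> (\<rho> * q / (l i * norm (F y)))\<^sup>2"
  \<comment> \<open>In the degenerate case \<open>q = 0\<close>, which forces \<open>a = 0\<close>,
    so nothing is claimed beyond nonnegativity of a square.\<close>
  proof (cases "F y = 0 \<or> F x = 0")
    case True
    then have "(1 - \<rho>) * a\<^sup>2 \<le> 0"
      using q by (auto simp: q_def)
    then have "a = 0"
      using \<rho> by (simp add: mult_le_0_iff)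
    then show ?thesis by simp
  next
    case False
    have "l i * norm (F y) \<le> (l i + \<rho> * L) * norm (F x)"
      unfolding y_def by (rule norm_at_mini_eg_y_le[OF lip l \<rho>(1)])
    also have "\<dots> \<le> B * norm (F x)"
      using B by (intro mult_right_mono) auto
    finally have "\<rho> * ((1 - \<rho>) * a\<^sup>2) / (B * norm (F x)) \<le> \<rho> * q / (l i * norm (F y))"
      using False q \<rho> l[of i] order_trans[OF _ q, of 0] by (intro frac_le mult_left_mono) auto
    then have "(\<rho> * ((1 - \<rho>) * a\<^sup>2) / (B * norm (F x)))\<^sup>2 \<le> (\<rho> * q / (l i * norm (F y)))\<^sup>2"
      using \<rho> B by (intro power_mono) auto
    then show ?thesis
      by (simp add: C_def B_def power_divide power_mult_distrib mult.assoc flip: power_mult)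
  qed
  then show ?thesis
    using mini_eg_step_dist_le[OF mono l cl \<Omega> z \<rho>, of i x]
    by (simp add: y_def a_def q_def)
qed

section \<open>Averaging over the random index\<close>

lemma mini_eg_cong:
  "(\<And>j. j < k \<Longrightarrow> s j = t j) \<Longrightarrow> mini_eg F l \<rho> \<Omega> x0 s k = mini_eg F l \<rho> \<Omega> x0 t k"
  by (induction k) auto

text \<open>Iterate \<open>k\<close> is a function of the indices in \<open>{..<k}\<close>, a block
  disjoint from \<open>{k}\<close>.\<close>

lemma indep_var_mini_eg_index:
  fixes l :: "'n::finite \<Rightarrow> real" and g :: "real^'n \<Rightarrow> real" and h :: "'n \<Rightarrow> real"
  assumes "mini_eg_sampling l \<gamma> M I"
  shows "prob_space.indep_var M borel (\<lambda>\<omega>. g (mini_eg F l \<rho> \<Omega> x0 (\<lambda>j. I j \<omega>) k))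
    borel (\<lambda>\<omega>. h (I k \<omega>))"
proof -
  interpret prob_space M
    using assms by (simp add: mini_eg_sampling_def)
  let ?P = "\<lambda>A. PiM A (\<lambda>_::nat. count_space (UNIV :: 'n set))"
  have "indep_var (?P {..<k}) (\<lambda>\<omega>. restrict (\<lambda>j. I j \<omega>) {..<k})
      (?P {k}) (\<lambda>\<omega>. restrict (\<lambda>j. I j \<omega>) {k})"
    using assms by (intro indep_var_restrict[where I = UNIV]) (auto simp: mini_eg_sampling_def)
  \<comment> \<open>Finite blocks of indices carry the discrete sigma-algebra, so every function of
    them is measurable.\<close>
  moreover have "?P A = count_space (PiE A (\<lambda>_. UNIV))" if "finite A" for A
    using that by (intro count_space_PiM_finite) (auto intro: countable_finite)
  ultimately have "indep_var borel
      ((\<lambda>s. g (mini_eg F l \<rho> \<Omega> x0 s k)) \<circ> (\<lambda>\<omega>. restrict (\<lambda>j. I j \<omega>) {..<k}))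
      borel ((\<lambda>s. h (s k)) \<circ> (\<lambda>\<omega>. restrict (\<lambda>j. I j \<omega>) {k}))"
    by (intro indep_var_compose) auto
  moreover have "mini_eg F l \<rho> \<Omega> x0 (restrict (\<lambda>j. I j \<omega>) {..<k}) k
      = mini_eg F l \<rho> \<Omega> x0 (\<lambda>j. I j \<omega>) k" for \<omega>
    by (rule mini_eg_cong) simp
  ultimately show ?thesis
    by (simp add: comp_def)
qed

text \<open>Splitting over the values of \<open>I k\<close> with indicators gives a finite sum whose
  terms factor by independence. This plays the role of conditioning on the past.\<close>

lemma has_bochner_integral_mini_eg_index:
  fixes l :: "'n::finite \<Rightarrow> real" and g :: "'n \<Rightarrow> real^'n \<Rightarrow> real"
    and F :: "real^'n \<Rightarrow> real^'n" and \<rho> :: real and \<Omega> :: "(real^'n) set" and x0 :: "real^'n"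
    and I :: "nat \<Rightarrow> 'w \<Rightarrow> 'n"
  assumes samp: "mini_eg_sampling l \<gamma> M I"
  defines "x \<equiv> \<lambda>k \<omega>. mini_eg F l \<rho> \<Omega> x0 (\<lambda>j. I j \<omega>) k"
  shows "has_bochner_integral M (\<lambda>\<omega>. g (I k \<omega>) (x k \<omega>))
    (integral\<^sup>L M (\<lambda>\<omega>. \<Sum>i\<in>UNIV. l i powr \<gamma> * g i (x k \<omega>)) / (\<Sum>i\<in>UNIV. l i powr \<gamma>))"
proof -
  interpret prob_space M
    using samp by (simp add: mini_eg_sampling_def)
  have meas: "I k \<in> measurable M (count_space UNIV)"
    using samp by (simp add: mini_eg_sampling_def indep_vars_def2)
  let ?S = "\<Sum>i\<in>UNIV. l i powr \<gamma>"
  let ?h = "\<lambda>i \<omega>. indicator {i} (I k \<omega>) :: real"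
  have int: "integrable M (\<lambda>\<omega>. f (x k \<omega>))" for f :: "real^'n \<Rightarrow> real"
    unfolding x_def by (rule integrable_mini_eg[OF samp])
  have int_h: "integrable M (?h i)" for i
    using meas by (intro integrable_const_bound[where B = 1]) (auto split: split_indicator)
  have E_h: "expectation (?h i) = l i powr \<gamma> / ?S" for i
  proof -
    have "expectation (?h i) = expectation (indicator {\<omega> \<in> space M. I k \<omega> = i})"
      by (intro Bochner_Integration.integral_cong) (auto split: split_indicator)
    also have "\<dots> = l i powr \<gamma> / ?S"
      using samp by (simp add: mini_eg_sampling_def Int_def conj_commute)
    finally show ?thesis .
  qed
  have prod_int: "has_bochner_integral M (\<lambda>\<omega>. g i (x k \<omega>) * ?h i \<omega>)
      (expectation (\<lambda>\<omega>. g i (x k \<omega>)) * (l i powr \<gamma> / ?S))" for i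
  proof -
    have "indep_var borel (\<lambda>\<omega>. g i (x k \<omega>)) borel (?h i)"
      unfolding x_def by (rule indep_var_mini_eg_index[OF samp])
    from indep_var_integrable[OF this int int_h] indep_var_lebesgue_integral[OF this int int_h]
    show ?thesis
      by (simp add: has_bochner_integral_iff E_h)
  qed
  have "has_bochner_integral M (\<lambda>\<omega>. \<Sum>i\<in>UNIV. g i (x k \<omega>) * ?h i \<omega>)
      (\<Sum>i\<in>UNIV. expectation (\<lambda>\<omega>. g i (x k \<omega>)) * (l i powr \<gamma> / ?S))"
    by (intro has_bochner_integral_sum prod_int)
  moreover have "(\<Sum>i\<in>UNIV. g i (x k \<omega>) * ?h i \<omega>) = g (I k \<omega>) (x k \<omega>)" for \<omega>
    by (simp add: indicator_def if_distrib sum.delta cong: if_cong)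
  moreover have "(\<Sum>i\<in>UNIV. expectation (\<lambda>\<omega>. g i (x k \<omega>)) * (l i powr \<gamma> / ?S))
      = expectation (\<lambda>\<omega>. \<Sum>i\<in>UNIV. l i powr \<gamma> * g i (x k \<omega>)) / ?S"
    by (subst Bochner_Integration.integral_sum)
      (auto simp: sum_divide_distrib mult.commute intro!: integrable_mult_right integrable_mult_left int)
  ultimately show ?thesis
    by simp
qed

section \<open>Expected descent, telescoping and the two conclusions\<close>

theorem theorem3p9:
  fixes F :: "real^'n::finite \<Rightarrow> real^'n"
    and l :: "'n \<Rightarrow> real"
    and L \<rho> \<gamma> :: real
    and \<Omega> :: "(real^'n) set"
    and x0 xstar :: "real^'n"
    and M :: "'w measure"
    and I :: "nat \<Rightarrow> 'w \<Rightarrow> 'n"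
    and x :: "nat \<Rightarrow> 'w \<Rightarrow> real^'n"
  assumes "monotone_op F"
    and "L-lipschitz_on UNIV F"
    and "\<And>i. l i > 0"
    and "componentwise_lipschitz l F"
    and "\<Omega> \<noteq> {}" and "closed \<Omega>" and "convex \<Omega>"
    and "xstar \<in> \<Omega>" and "F xstar = 0"
    and "0 < \<rho>" and "\<rho> < 1" and "\<gamma> \<ge> 0"
    and "mini_eg_sampling l \<gamma> M I"
  defines "x \<equiv> \<lambda>k \<omega>. mini_eg F l \<rho> \<Omega> x0 (\<lambda>j. I j \<omega>) k"
  shows "(\<forall>K::nat.
      Min ((\<lambda>k. integral\<^sup>L M (\<lambda>\<omega>.
          (weighted_norm l \<gamma> (square_vec (F (x k \<omega>))))\<^sup>2 / (norm (F (x k \<omega>)))\<^sup>2)) ` {0..K})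
        \<le> (\<Sum>i\<in>UNIV. l i powr \<gamma>) * (Max (range l) + \<rho> * L)\<^sup>2
            / (\<rho>\<^sup>2 * (1 - \<rho>)\<^sup>2 * (real K + 1)) * (norm (x0 - xstar))\<^sup>2)
    \<and> liminf (\<lambda>k. ereal (integral\<^sup>L M (\<lambda>\<omega>. norm (F (x k \<omega>))))) = 0"
proof -
  interpret prob_space M
    using assms(13) by (simp add: mini_eg_sampling_def)
  define S B C where "S = (\<Sum>i\<in>UNIV. l i powr \<gamma>)" and "B = Max (range l) + \<rho> * L"
    and "C = \<rho>\<^sup>2 * (1 - \<rho>)\<^sup>2 / B\<^sup>2"
  define R where "R v = (weighted_norm l \<gamma> (square_vec (F v)))\<^sup>2 / (norm (F v))\<^sup>2" for v
  define e where "e k = expectation (\<lambda>\<omega>. R (x k \<omega>))" for k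
  define D where "D k = expectation (\<lambda>\<omega>. (norm (x k \<omega> - xstar))\<^sup>2)" for k
  have int: "integrable M (\<lambda>\<omega>. f (x k \<omega>))" for f :: "real^'n \<Rightarrow> real" and k
    unfolding x_def by (rule integrable_mini_eg[OF assms(13)])
  have S: "S > 0"
    unfolding S_def by (intro sum_pos) (simp_all add: assms(3) less_imp_neq[THEN not_sym])
  \<comment> \<open>Here \<open>undefined\<close> serves as an arbitrary index: any value of
    \<open>l\<close> is positive and at most the maximum.\<close>
  have "0 < Max (range l)"
    using assms(3) by (rule order.strict_trans2[of 0 "l undefined"]) simp
  then have B: "B > 0"
    using lipschitz_on_nonneg[OF assms(2)] assms(10) by (simp add: B_def add_pos_nonneg)
  have C: "C > 0"
    using assms(10,11) B by (simp add: C_def)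
  have e_nonneg: "e k \<ge> 0" for k
    unfolding e_def R_def by (intro integral_nonneg_AE) simp
  have D_nonneg: "D k \<ge> 0" for k
    unfolding D_def by (intro integral_nonneg_AE) simp
  \<comment> \<open>The factor \<open>1 / S\<close> normalises the sampling probabilities: averaging
    the fourth power over \<open>I k\<close> gives \<open>e k / S\<close>.\<close>
  have descent: "C / S * e k \<le> D k - D (Suc k)" for k
  proof -
    let ?r = "\<lambda>\<omega>. (F (x k \<omega>) $ I k \<omega>)^4 / (norm (F (x k \<omega>)))\<^sup>2"
    have "has_bochner_integral M ?r (expectation (\<lambda>\<omega>. \<Sum>i\<in>UNIV. l i powr \<gamma> *
        ((F (x k \<omega>) $ i)^4 / (norm (F (x k \<omega>)))\<^sup>2)) / S)"
      unfolding x_def S_def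
      by (rule has_bochner_integral_mini_eg_index[OF assms(13), of "\<lambda>i v. (F v $ i)^4 / (norm (F v))\<^sup>2"])
    then have r: "has_bochner_integral M ?r (e k / S)"
      by (simp add: e_def R_def weighted_norm_square_vec_sq[OF assms(3)] sum_divide_distrib)
    have "D (Suc k) \<le> expectation (\<lambda>\<omega>. (norm (x k \<omega> - xstar))\<^sup>2 - C * ?r \<omega>)"
      unfolding D_def
    proof (rule integral_mono)
      show "integrable M (\<lambda>\<omega>. (norm (x (Suc k) \<omega> - xstar))\<^sup>2)"
        by (rule int)
      show "integrable M (\<lambda>\<omega>. (norm (x k \<omega> - xstar))\<^sup>2 - C * ?r \<omega>)"
        by (intro Bochner_Integration.integrable_diff integrable_mult_right integrable.intros[OF r]
            int[of "\<lambda>v. (norm (v - xstar))\<^sup>2"])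
      show "(norm (x (Suc k) \<omega> - xstar))\<^sup>2 \<le> (norm (x k \<omega> - xstar))\<^sup>2 - C * ?r \<omega>" for \<omega>
        unfolding x_def mini_eg.simps C_def B_def
        by (rule mini_eg_step_descent[OF assms(1-4,6-11)])
    qed
    also have "\<dots> = D k - C * (e k / S)"
      unfolding D_def
      by (intro has_bochner_integral_integral_eq has_bochner_integral_diff
          has_bochner_integral_mult_right r has_bochner_integral_integrable
          int[of "\<lambda>v. (norm (v - xstar))\<^sup>2"])
    finally show ?thesis by simp
  qed
  have D0: "D 0 = (norm (x0 - xstar))\<^sup>2"
    by (simp add: D_def x_def prob_space)
  \<comment> \<open>The bound is uniform in \<open>K\<close>, so it yields both the rate for the
    minimum and the summability of \<open>e\<close>.\<close>
  have sum_e: "(\<Sum>k\<le>K. e k) \<le> S / C * (norm (x0 - xstar))\<^sup>2" for K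
  proof -
    have "C / S * (\<Sum>k\<le>K. e k) \<le> (\<Sum>k\<le>K. D k - D (Suc k))"
      unfolding sum_distrib_left by (intro sum_mono descent)
    also have "\<dots> \<le> (norm (x0 - xstar))\<^sup>2"
      using D_nonneg[of "Suc K"] by (simp add: sum_telescope D0)
    finally show ?thesis
      using S C by (simp add: field_simps)
  qed
  have "Min (e ` {0..K}) \<le> S * B\<^sup>2 / (\<rho>\<^sup>2 * (1 - \<rho>)\<^sup>2 * (real K + 1)) * (norm (x0 - xstar))\<^sup>2" for K
  proof -
    \<comment> \<open>The minimum is at most each of the \<open>K + 1\<close> terms, hence at most
      their average.\<close>
    have "(\<Sum>k\<le>K. Min (e ` {0..K})) \<le> (\<Sum>k\<le>K. e k)"
      by (intro sum_mono Min_le) auto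
    with sum_e[of K] have "(real K + 1) * Min (e ` {0..K}) \<le> S / C * (norm (x0 - xstar))\<^sup>2"
      by (simp add: algebra_simps)
    then have "Min (e ` {0..K}) \<le> S / C * (norm (x0 - xstar))\<^sup>2 / (real K + 1)"
      by (subst pos_le_divide_eq) (simp_all add: mult.commute)
    also have "\<dots> = S * B\<^sup>2 / (\<rho>\<^sup>2 * (1 - \<rho>)\<^sup>2 * (real K + 1)) * (norm (x0 - xstar))\<^sup>2"
      by (simp add: C_def)
    finally show ?thesis .
  qed
  moreover have "liminf (\<lambda>k. ereal (expectation (\<lambda>\<omega>. norm (F (x k \<omega>))))) = 0"
  proof -
    define c where "c = (\<Sum>i\<in>UNIV. 1 / l i powr \<gamma>)"
    let ?E = "\<lambda>k. expectation (\<lambda>\<omega>. norm (F (x k \<omega>)))"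
    \<comment> \<open>Nonnegative terms with bounded partial sums tend to 0. This gives a genuine
      limit for the expected norms, of which the liminf is a special case.\<close>
    have "summable e"
      using e_nonneg sum_e by (intro bounded_imp_summable)
    then have "(\<lambda>k. sqrt (c * e k)) \<longlonglongrightarrow> sqrt (c * 0)"
      by (intro tendsto_intros summable_LIMSEQ_zero)
    moreover have "?E k \<le> sqrt (c * e k)" for k
    proof (rule real_le_rsqrt)
      \<comment> \<open>Nonnegativity of the variance serves as Jensen's inequality for the
        square.\<close>
      have "(?E k)\<^sup>2 \<le> expectation (\<lambda>\<omega>. (norm (F (x k \<omega>)))\<^sup>2)"
        using variance_positive[of "\<lambda>\<omega>. norm (F (x k \<omega>))"]
        by (subst (asm) variance_eq)
          (auto intro: int[of "\<lambda>v. norm (F v)"] int[of "\<lambda>v. (norm (F v))\<^sup>2"])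
      also have "\<dots> \<le> expectation (\<lambda>\<omega>. c * R (x k \<omega>))"
        unfolding R_def c_def
        by (intro integral_mono norm_sq_le_weighted_norm_ratio assms(3)
            int[of "\<lambda>v. (norm (F v))\<^sup>2"] integrable_mult_right
            int[of "\<lambda>v. (weighted_norm l \<gamma> (square_vec (F v)))\<^sup>2 / (norm (F v))\<^sup>2"])
      finally show "(?E k)\<^sup>2 \<le> c * e k"
        by (simp add: e_def)
    qed
    moreover have "0 \<le> ?E k" for k
      by simp
    ultimately have "?E \<longlonglongrightarrow> 0"
      by (intro tendsto_sandwich[of "\<lambda>_. 0" ?E sequentially "\<lambda>k. sqrt (c * e k)"]) auto
    then have "(\<lambda>k. ereal (?E k)) \<longlonglongrightarrow> 0"
      by (simp add: zero_ereal_def)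
    then show ?thesis
      by (intro lim_imp_Liminf) auto
  qed
  ultimately show ?thesis
    unfolding e_def R_def S_def B_def by blast
qed

end
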